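(* Let $\mathcal S=\{1,2\}$, and let $(X,\Lambda)$, the rates $q_{ij}(x)$, $\bar q_{ij}$, $q^*_{ij}$, and the processes $\bar\Lambda$, $\Lambda^*$ (all driven by one and the same Poisson random measure $N$, with $\bar\Lambda(0)=\Lambda^*(0)=\Lambda(0)$) be as defined in the context. (i) If $\bar q_{21}>0$ and $\bar q_{12}+\bar q_{21}\le q_{12}(x)+q_{21}(x)$ for all $x\in\mathbb R^d$, then almost surely $\Lambda(t)\le\bar\Lambda(t)$ for all $t\ge0$. (ii) If $q^*_{12}>0$ and $q^*_{12}+q^*_{21}\ge q_{12}(x)+q_{21}(x)$ for all $x\in\mathbb R^d$, then almost surely $\Lambda^*(t)\le\Lambda(t)$ for all $t\ge0$.
   Context: Setting. Let $\tau>0$, $\delta(t)=[t/\tau]\tau$ ($[\cdot]$ integer part), $\mathcal S=\{1,2\}$, $a:\mathbb R^d\times\mathcal S\to\mathbb R^d$, $\sigma:\mathbb R^d\times\mathcal S\to\mathbb R^{d\times d}$, $b:\mathcal S\to\mathbb R$. For each $x$, $Q_x=(q_{ij}(x))_{i,j\in\mathcal S}$ is a conservative $Q$-matrix (nonnegative off-diagonal entries, zero row sums), $q_i(x)=-q_{ii}(x)$. Standing assumptions: there are $C,c:\mathcal S\to[0,\infty)$ with $c(i)|x|^2\le2\langle a(x,i),x\rangle+\|\sigma(x,i)\|_{\mathrm{HS}}^2\le C(i)|x|^2$ for all $(x,i)$; $a(\cdot,i)$ and $\sigma(\cdot,i)$ are globally Lipschitz; $x\mapsto q_{ij}(x)$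 is continuous; $H:=\sup_{x}\max_i q_i(x)<\infty$; and $Q_x$ is irreducible for each $x$. Let $L=2H$ and let $N(dt,du)$ be a Poisson random measure on $(0,\infty)\times[0,L]$ with intensity $dt\times\mathbf m(du)$, $\mathbf m$ Lebesgue measure, independent of the $d$-dimensional Wiener process $W$. Put $\Gamma_{12}(x)=[0,q_{12}(x))$, $\Gamma_{21}(x)=[q_1(x),q_1(x)+q_{21}(x))$ (note $q_1(x)=q_{12}(x)$), and $h(x,1,u)=\mathbf 1_{\Gamma_{12}(x)}(u)$, $h(x,2,u)=-\mathbf 1_{\Gamma_{21}(x)}(u)$. The pair $(X,\Lambda)$ solves $$dX(t)=[a(X(t),\Lambda(t))-b(\Lambda(\delta(t)))X(\delta(t))]dt+\sigma(X(t),\Lambda(t))dW(t),$$ $$d\Lambda(t)=\int_{[0,L]}h(X(t),\Lambda(t-),u)N(dt,du),\qquad \Lambda(0)=i_0\in\mathcal S .$$ Define $\bar q_{12}=\sup_xq_{12}(x)$, $\bar q_{21}=\inf_xq_{21}(x)$, $q^*_{12}=\inf_xq_{12}(x)$, $q^*_{21}=\sup_xq_{21}(x)$, with $\bar q_{ii},q^*_{ii}$ chosen so that the rows of $\bar Q=(\bar q_{ij})$, $Q^*=(q_{ij}^* )$ sum to zero. Let $\bar\Gamma_{12}=[0,\bar q_{12})$, $\bar\Gamma_{21}=[\bar q_{12},\bar q_{12}+\bar q_{21})$, $\Gamma^*_{12}=[0,q^*_{12})$, $\Gamma^*_{21}=[q^*_{12},q^*_{12}+q^*_{21})$; $\bar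 g(1,u)=\mathbf 1_{\bar\Gamma_{12}}(u)$, $\bar g(2,u)=-\mathbf 1_{\bar\Gamma_{21}}(u)$, $g^*(1,u)=\mathbf 1_{\Gamma^*_{12}}(u)$, $g^*(2,u)=-\mathbf 1_{\Gamma^*_{21}}(u)$. With the same $N$, $$d\bar\Lambda(t)=\int_{[0,L]}\bar g(\bar\Lambda(t-),u)N(dt,du),\quad d\Lambda^*(t)=\int_{[0,L]}g^*(\Lambda^*(t-),u)N(dt,du),\quad \bar\Lambda(0)=\Lambda^*(0)=\Lambda(0).$$ These are continuous-time Markov chains with $Q$-matrices $\bar Q$ and $Q^*$. *)

theory Defs
  imports "HOL-Probability.Probability"
begin

section \<open>Coefficients and switching rates\<close>

text \<open>The state space \<open>{1, 2}\<close> is a subset of \<^typ>\<open>int\<close>, since the driving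
  coefficients of the switching process are jump sizes in \<open>{-1, 0, 1}\<close>. Functions of the state
  are only constrained on \<open>{1, 2}\<close>.\<close>

abbreviation states :: "int set" where "states \<equiv> {1, 2}"

definition hs_norm :: "real^'m^'n \<Rightarrow> real" where
  "hs_norm A = sqrt (\<Sum>i\<in>UNIV. \<Sum>j\<in>UNIV. (A $ i $ j)\<^sup>2)"

definition conservative_Q_matrix :: "(int \<Rightarrow> int \<Rightarrow> real) \<Rightarrow> bool" where
  "conservative_Q_matrix R \<longleftrightarrow>
     (\<forall>i\<in>states. \<forall>j\<in>states. i \<noteq> j \<longrightarrow> 0 \<le> R i j) \<and> (\<forall>i\<in>states. (\<Sum>j\<in>states. R i j) = 0)"

definition irreducible_Q_matrix :: "(int \<Rightarrow> int \<Rightarrow> real) \<Rightarrow> bool" where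
  "irreducible_Q_matrix R \<longleftrightarrow>
     (\<forall>i\<in>states. \<forall>j\<in>states. (i, j) \<in> {(k, l). k \<in> states \<and> l \<in> states \<and> k \<noteq> l \<and> 0 < R k l}\<^sup>*)"

definition max_rate :: "('x \<Rightarrow> int \<Rightarrow> int \<Rightarrow> real) \<Rightarrow> 'x \<Rightarrow> real" where
  "max_rate q x = (MAX i\<in>states. - q x i i)"

definition rate_bound :: "('x \<Rightarrow> int \<Rightarrow> int \<Rightarrow> real) \<Rightarrow> real" where
  "rate_bound q = (SUP x. max_rate q x)"

definition standing_assumptions ::
    "(real^'d \<Rightarrow> int \<Rightarrow> real^'d) \<Rightarrow> (real^'d \<Rightarrow> int \<Rightarrow> real^'d^'d) \<Rightarrow>
     (real^'d \<Rightarrow> int \<Rightarrow> int \<Rightarrow> real) \<Rightarrow> bool" where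
  "standing_assumptions a \<sigma> q \<longleftrightarrow>
     (\<exists>C c. (\<forall>i\<in>states. 0 \<le> C i \<and> 0 \<le> c i) \<and>
        (\<forall>x. \<forall>i\<in>states. c i * (norm x)\<^sup>2 \<le> 2 * (a x i \<bullet> x) + (hs_norm (\<sigma> x i))\<^sup>2 \<and>
                       2 * (a x i \<bullet> x) + (hs_norm (\<sigma> x i))\<^sup>2 \<le> C i * (norm x)\<^sup>2)) \<and>
     (\<forall>i\<in>states. \<exists>K. K-lipschitz_on UNIV (\<lambda>x. a x i)) \<and>
     (\<forall>i\<in>states. \<exists>K. K-lipschitz_on UNIV (\<lambda>x. \<sigma> x i)) \<and>
     (\<forall>x. conservative_Q_matrix (q x)) \<and>
     (\<forall>i\<in>states. \<forall>j\<in>states. continuous_on UNIV (\<lambda>x. q x i j)) \<and>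
     bdd_above (range (max_rate q)) \<and>
     (\<forall>x. irreducible_Q_matrix (q x))"

definition Q_of_rates :: "real \<Rightarrow> real \<Rightarrow> int \<Rightarrow> int \<Rightarrow> real" where
  "Q_of_rates \<alpha> \<beta> i j =
     (if i = 1 then (if j = 1 then - \<alpha> else if j = 2 then \<alpha> else 0)
      else if i = 2 then (if j = 1 then \<beta> else if j = 2 then - \<beta> else 0)
      else 0)"

definition Q_bar :: "('x \<Rightarrow> int \<Rightarrow> int \<Rightarrow> real) \<Rightarrow> int \<Rightarrow> int \<Rightarrow> real" where
  "Q_bar q = Q_of_rates (SUP x. q x 1 2) (INF x. q x 2 1)"

definition Q_star :: "('x \<Rightarrow> int \<Rightarrow> int \<Rightarrow> real) \<Rightarrow> int \<Rightarrow> int \<Rightarrow> real" where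
  "Q_star q = Q_of_rates (INF x. q x 1 2) (SUP x. q x 2 1)"

text \<open>For a conservative matrix \<open>R\<close> one has \<open>- R 1 1 = R 1 2\<close>. Thus, with \<open>R = q x\<close>, the
  interval used in state \<open>2\<close> is \<open>[q\<^sub>1(x), q\<^sub>1(x) + q\<^sub>2\<^sub>1(x))\<close>, and \<open>jump_coeff (q x)\<close> is
  \<open>h(x, \<cdot>, \<cdot>)\<close>.\<close>

definition jump_coeff :: "(int \<Rightarrow> int \<Rightarrow> real) \<Rightarrow> int \<Rightarrow> real \<Rightarrow> int" where
  "jump_coeff R i u =
     (if i = 1 then indicator {0..<R 1 2} u
      else if i = 2 then - indicator {R 1 2..<R 1 2 + R 2 1} u
      else 0)"


section \<open>Filtrations and driving noises\<close>

text \<open>Only times \<open>t \<ge> 0\<close> matter below; a filtration indexed by \<open>[0, \<infinity>)\<close> is extended to all reals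
  by \<open>F t = F 0\<close> for \<open>t < 0\<close>.\<close>

definition filtered_prob_space :: "'w measure \<Rightarrow> (real \<Rightarrow> 'w measure) \<Rightarrow> bool" where
  "filtered_prob_space M F \<longleftrightarrow>
     prob_space M \<and> filtration (space M) F \<and> (\<forall>t. subalgebra M (F t))"

definition wiener_process ::
    "'w measure \<Rightarrow> (real \<Rightarrow> 'w measure) \<Rightarrow> (real \<Rightarrow> 'w \<Rightarrow> real^'d) \<Rightarrow> bool" where
  "wiener_process M F W \<longleftrightarrow>
     (\<forall>t\<ge>0. W t \<in> borel_measurable (F t)) \<and>
     (AE \<omega> in M. W 0 \<omega> = 0 \<and> continuous_on {0..} (\<lambda>t. W t \<omega>)) \<and>
     (\<forall>s t. 0 \<le> s \<and> s < t \<longrightarrow>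
        prob_space.indep_set M (sets (F s))
          (sets (vimage_algebra (space M) (\<lambda>\<omega>. W t \<omega> - W s \<omega>) borel)) \<and>
        prob_space.indep_vars M (\<lambda>_. borel) (\<lambda>i \<omega>. (W t \<omega> - W s \<omega>) $ i) UNIV \<and>
        (\<forall>i. distributed M lborel (\<lambda>\<omega>. (W t \<omega> - W s \<omega>) $ i) (normal_density 0 (sqrt (t - s)))))"

definition poisson_random_measure :: "'w measure \<Rightarrow> 'e measure \<Rightarrow> ('w \<Rightarrow> 'e measure) \<Rightarrow> bool" where
  "poisson_random_measure M \<mu> N \<longleftrightarrow>
     (\<forall>\<omega>\<in>space M. sets (N \<omega>) = sets \<mu> \<and>
        (\<forall>A\<in>sets \<mu>. emeasure (N \<omega>) A = \<infinity> \<or> (\<exists>k::nat. emeasure (N \<omega>) A = of_nat k))) \<and>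
     (\<forall>A\<in>sets \<mu>. (\<lambda>\<omega>. emeasure (N \<omega>) A) \<in> borel_measurable M) \<and>
     (\<forall>A\<in>sets \<mu>. emeasure \<mu> A < \<infinity> \<longrightarrow>
        (\<forall>k::nat. measure M {\<omega>\<in>space M. emeasure (N \<omega>) A = of_nat k} =
           measure \<mu> A ^ k / fact k * exp (- measure \<mu> A))) \<and>
     (\<forall>A\<in>sets \<mu>. emeasure \<mu> A = \<infinity> \<longrightarrow> (AE \<omega> in M. emeasure (N \<omega>) A = \<infinity>)) \<and>
     (\<forall>A n. (\<forall>i<n::nat. A i \<in> sets \<mu>) \<and> disjoint_family_on A {..<n} \<longrightarrow>
        prob_space.indep_vars M (\<lambda>_. borel) (\<lambda>i \<omega>. emeasure (N \<omega>) (A i)) {..<n})"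

definition intensity :: "real \<Rightarrow> (real \<times> real) measure" where
  "intensity L = restrict_space lborel {0<..} \<Otimes>\<^sub>M restrict_space lborel {0..L}"

definition random_measure_algebra ::
    "'w measure \<Rightarrow> 'e set set \<Rightarrow> ('w \<Rightarrow> 'e measure) \<Rightarrow> 'w measure" where
  "random_measure_algebra M \<A> N =
     vimage_algebra (space M) (\<lambda>\<omega>. \<lambda>A\<in>\<A>. emeasure (N \<omega>) A) (\<Pi>\<^sub>M A\<in>\<A>. borel)"

definition process_algebra :: "'w measure \<Rightarrow> (real \<Rightarrow> 'w \<Rightarrow> real^'d) \<Rightarrow> 'w measure" where
  "process_algebra M W =
     vimage_algebra (space M) (\<lambda>\<omega>. \<lambda>t\<in>{0..}. W t \<omega>) (\<Pi>\<^sub>M t\<in>{0..}. borel)"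

definition poisson_noise ::
    "'w measure \<Rightarrow> (real \<Rightarrow> 'w measure) \<Rightarrow> real \<Rightarrow> ('w \<Rightarrow> (real \<times> real) measure) \<Rightarrow> bool" where
  "poisson_noise M F L N \<longleftrightarrow>
     poisson_random_measure M (intensity L) N \<and>
     (\<forall>t\<ge>0. \<forall>A\<in>sets (intensity L). A \<subseteq> {0<..t} \<times> UNIV \<longrightarrow>
        (\<lambda>\<omega>. emeasure (N \<omega>) A) \<in> borel_measurable (F t)) \<and>
     (\<forall>t\<ge>0. prob_space.indep_set M (sets (F t))
        (sets (random_measure_algebra M {A \<in> sets (intensity L). A \<subseteq> {t<..} \<times> UNIV} N)))"

definition independent_noises ::
    "'w measure \<Rightarrow> real \<Rightarrow> (real \<Rightarrow> 'w \<Rightarrow> real^'d) \<Rightarrow> ('w \<Rightarrow> (real \<times> real) measure) \<Rightarrow> bool" where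
  "independent_noises M L W N \<longleftrightarrow>
     prob_space.indep_set M (sets (process_algebra M W))
       (sets (random_measure_algebra M (sets (intensity L)) N))"


section \<open>The Ito integral\<close>

text \<open>A simple process is \<open>\<Sum>k<n. \<xi>\<^sub>k 1_{(\<tau>\<^sub>k, \<tau>\<^sub>k\<^sub>+\<^sub>1]}\<close> with bounded, \<open>F (\<tau>\<^sub>k)\<close>-measurable \<open>\<xi>\<^sub>k\<close>.
  The integral of an adapted process with locally square integrable paths is the limit,
  uniformly on compact time intervals in probability, of the integrals of simple processes
  that approximate it in \<open>L\<^sup>2([0, T])\<close> in probability.\<close>

definition simple_process ::
    "'w measure \<Rightarrow> (real \<Rightarrow> 'w measure) \<Rightarrow> nat \<Rightarrow> (nat \<Rightarrow> real) \<Rightarrow> (nat \<Rightarrow> 'w \<Rightarrow> real^'m^'n) \<Rightarrow> bool" where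
  "simple_process M F n \<tau> \<xi> \<longleftrightarrow>
     0 \<le> \<tau> 0 \<and> (\<forall>k<n. \<tau> k < \<tau> (Suc k)) \<and>
     (\<forall>k<n. \<xi> k \<in> borel_measurable (F (\<tau> k)) \<and> bounded (\<xi> k ` space M))"

definition simple_value ::
    "nat \<Rightarrow> (nat \<Rightarrow> real) \<Rightarrow> (nat \<Rightarrow> 'w \<Rightarrow> real^'m^'n) \<Rightarrow> real \<Rightarrow> 'w \<Rightarrow> real^'m^'n" where
  "simple_value n \<tau> \<xi> t \<omega> = (\<Sum>k<n. indicator {\<tau> k<..\<tau> (Suc k)} t *\<^sub>R \<xi> k \<omega>)"

definition simple_ito_integral ::
    "(real \<Rightarrow> 'w \<Rightarrow> real^'m) \<Rightarrow> nat \<Rightarrow> (nat \<Rightarrow> real) \<Rightarrow> (nat \<Rightarrow> 'w \<Rightarrow> real^'m^'n) \<Rightarrow>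
     real \<Rightarrow> 'w \<Rightarrow> real^'n" where
  "simple_ito_integral W n \<tau> \<xi> t \<omega> =
     (\<Sum>k<n. \<xi> k \<omega> *v (W (min t (\<tau> (Suc k))) \<omega> - W (min t (\<tau> k)) \<omega>))"

text \<open>The outer measure avoids a measurability side condition: without completeness of \<open>M\<close>, a
  supremum over an uncountable time interval need not be measurable.\<close>

definition null_in_probability :: "'w measure \<Rightarrow> (nat \<Rightarrow> 'w \<Rightarrow> ennreal) \<Rightarrow> bool" where
  "null_in_probability M Y \<longleftrightarrow>
     (\<forall>\<epsilon>>0. (\<lambda>m. outer_measure_of M {\<omega>\<in>space M. ennreal \<epsilon> < Y m \<omega>}) \<longlonglongrightarrow> 0)"

definition has_ito_integral ::
    "'w measure \<Rightarrow> (real \<Rightarrow> 'w measure) \<Rightarrow> (real \<Rightarrow> 'w \<Rightarrow> real^'m) \<Rightarrow>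
     (real \<Rightarrow> 'w \<Rightarrow> real^'m^'n) \<Rightarrow> (real \<Rightarrow> 'w \<Rightarrow> real^'n) \<Rightarrow> bool" where
  "has_ito_integral M F W f I \<longleftrightarrow>
     (\<forall>t\<ge>0. f t \<in> borel_measurable (F t)) \<and>
     (AE \<omega> in M. set_borel_measurable lborel {0..} (\<lambda>s. f s \<omega>) \<and>
        (\<forall>T\<ge>0. (\<integral>\<^sup>+ s\<in>{0..T}. ennreal ((hs_norm (f s \<omega>))\<^sup>2) \<partial>lborel) < \<infinity>)) \<and>
     (\<exists>n \<tau> \<xi>. (\<forall>m. simple_process M F (n m) (\<tau> m) (\<xi> m)) \<and>
        (\<forall>T\<ge>0. null_in_probability M
           (\<lambda>m \<omega>. \<integral>\<^sup>+ s\<in>{0..T}.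
              ennreal ((hs_norm (simple_value (n m) (\<tau> m) (\<xi> m) s \<omega> - f s \<omega>))\<^sup>2) \<partial>lborel)) \<and>
        (\<forall>T\<ge>0. null_in_probability M
           (\<lambda>m \<omega>. SUP t\<in>{0..T}.
              ennreal (norm (simple_ito_integral W (n m) (\<tau> m) (\<xi> m) t \<omega> - I t \<omega>)))))"


section \<open>Solutions\<close>

definition cadlag :: "(real \<Rightarrow> 'b::topological_space) \<Rightarrow> bool" where
  "cadlag f \<longleftrightarrow> (\<forall>t\<ge>0. (f \<longlongrightarrow> f t) (at_right t)) \<and> (\<forall>t>0. \<exists>l. (f \<longlongrightarrow> l) (at_left t))"

definition left_limit :: "(real \<Rightarrow> 'b::t2_space) \<Rightarrow> real \<Rightarrow> 'b" where
  "left_limit f t = Lim (at_left t) f"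

definition grid_time :: "real \<Rightarrow> real \<Rightarrow> real" where
  "grid_time \<tau> t = of_int \<lfloor>t / \<tau>\<rfloor> * \<tau>"

text \<open>\<open>jump_solution M F L N \<kappa> i\<^sub>0 \<Lambda>\<close>: \<open>\<Lambda>\<close> is an adapted, \<open>{1, 2}\<close>-valued cadlag solution of
  \<open>d\<Lambda>(t) = \<integral>\<^bsub>[0, L]\<^esub> \<kappa>(t, \<Lambda>(t-), u) N(dt, du)\<close>, \<open>\<Lambda>(0) = i\<^sub>0\<close>, where \<open>\<kappa>\<close> may be random.\<close>

definition jump_solution ::
    "'w measure \<Rightarrow> (real \<Rightarrow> 'w measure) \<Rightarrow> real \<Rightarrow> ('w \<Rightarrow> (real \<times> real) measure) \<Rightarrow>
     (real \<Rightarrow> 'w \<Rightarrow> int \<Rightarrow> real \<Rightarrow> int) \<Rightarrow> int \<Rightarrow> (real \<Rightarrow> 'w \<Rightarrow> int) \<Rightarrow> bool" where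
  "jump_solution M F L N \<kappa> i\<^sub>0 \<Lambda> \<longleftrightarrow>
     (\<forall>t\<ge>0. \<Lambda> t \<in> measurable (F t) (count_space UNIV)) \<and>
     (AE \<omega> in M.
        cadlag (\<lambda>t. \<Lambda> t \<omega>) \<and> (\<forall>t\<ge>0. \<Lambda> t \<omega> \<in> states) \<and>
        (\<forall>t\<ge>0.
           set_integrable (N \<omega>) ({0<..t} \<times> {0..L})
             (\<lambda>(s, u). real_of_int (\<kappa> s \<omega> (left_limit (\<lambda>r. \<Lambda> r \<omega>) s) u)) \<and>
           real_of_int (\<Lambda> t \<omega>) = real_of_int i\<^sub>0 +
             set_lebesgue_integral (N \<omega>) ({0<..t} \<times> {0..L})
               (\<lambda>(s, u). real_of_int (\<kappa> s \<omega> (left_limit (\<lambda>r. \<Lambda> r \<omega>) s) u))))"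

definition diffusion_solution ::
    "'w measure \<Rightarrow> (real \<Rightarrow> 'w measure) \<Rightarrow> real \<Rightarrow> (real^'d \<Rightarrow> int \<Rightarrow> real^'d) \<Rightarrow>
     (real^'d \<Rightarrow> int \<Rightarrow> real^'d^'d) \<Rightarrow> (int \<Rightarrow> real) \<Rightarrow> (real \<Rightarrow> 'w \<Rightarrow> real^'d) \<Rightarrow>
     (real \<Rightarrow> 'w \<Rightarrow> real^'d) \<Rightarrow> (real \<Rightarrow> 'w \<Rightarrow> int) \<Rightarrow> bool" where
  "diffusion_solution M F \<tau> a \<sigma> b W X \<Lambda> \<longleftrightarrow>
     (\<forall>t\<ge>0. X t \<in> borel_measurable (F t)) \<and>
     (AE \<omega> in M. continuous_on {0..} (\<lambda>t. X t \<omega>)) \<and>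
     (\<exists>I. has_ito_integral M F W (\<lambda>s \<omega>. \<sigma> (X s \<omega>) (\<Lambda> s \<omega>)) I \<and>
        (AE \<omega> in M. \<forall>t\<ge>0.
           set_integrable lborel {0..t}
             (\<lambda>s. a (X s \<omega>) (\<Lambda> s \<omega>) - b (\<Lambda> (grid_time \<tau> s) \<omega>) *\<^sub>R X (grid_time \<tau> s) \<omega>) \<and>
           X t \<omega> = X 0 \<omega> +
             (LINT s:{0..t}|lborel.
                a (X s \<omega>) (\<Lambda> s \<omega>) - b (\<Lambda> (grid_time \<tau> s) \<omega>) *\<^sub>R X (grid_time \<tau> s) \<omega>) +
             I t \<omega>))"

definition switching_diffusion_solution ::
    "'w measure \<Rightarrow> (real \<Rightarrow> 'w measure) \<Rightarrow> real \<Rightarrow> (real^'d \<Rightarrow> int \<Rightarrow> real^'d) \<Rightarrow>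
     (real^'d \<Rightarrow> int \<Rightarrow> real^'d^'d) \<Rightarrow> (int \<Rightarrow> real) \<Rightarrow> (real^'d \<Rightarrow> int \<Rightarrow> int \<Rightarrow> real) \<Rightarrow> real \<Rightarrow>
     (real \<Rightarrow> 'w \<Rightarrow> real^'d) \<Rightarrow> ('w \<Rightarrow> (real \<times> real) measure) \<Rightarrow> int \<Rightarrow>
     (real \<Rightarrow> 'w \<Rightarrow> real^'d) \<Rightarrow> (real \<Rightarrow> 'w \<Rightarrow> int) \<Rightarrow> bool" where
  "switching_diffusion_solution M F \<tau> a \<sigma> b q L W N i\<^sub>0 X \<Lambda> \<longleftrightarrow>
     diffusion_solution M F \<tau> a \<sigma> b W X \<Lambda> \<and>
     jump_solution M F L N (\<lambda>s \<omega>. jump_coeff (q (X s \<omega>))) i\<^sub>0 \<Lambda>"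

end

theory Submission
  imports Defs
begin

text \<open>Since \<open>[0, L]\<close> has finite mass, almost surely every time \<open>s > 0\<close> ends an interval
  \<open>(r, s]\<close> carrying at most one atom of \<open>N\<close>. If \<open>i \<le> j\<close>, then an atom with mark \<open>u\<close> moves the
  smaller chain from \<open>i\<close> and the larger one from \<open>j\<close> to states that are still ordered: the
  inequalities between the rates give the inclusions of the jump intervals needed for \<open>i = j\<close>,
  and for \<open>i = 1\<close>, \<open>j = 2\<close> the two intervals are disjoint, so that the chains do not swap. Hence
  the order cannot break at the first time at which it would have to.\<close>

section \<open>Monotonicity of the jumps\<close>

text \<open>With \<open>R\<close> driving the smaller chain: both up-intervals start at 0 and that
  of \<open>R\<close> ends no later; the down-interval of \<open>R\<close> starts no later and ends
  no earlier than that of \<open>R'\<close>. From states 1 and 2 a swap would need a mark below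
  \<open>R 1 2\<close> and at least \<open>R' 1 2\<close>.\<close>

lemma jump_coeff_mono:
  assumes "i \<in> states" "j \<in> states" "i \<le> j"
    and "R 1 2 \<le> R' 1 2" "R' 1 2 + R' 2 1 \<le> R 1 2 + R 2 1"
  shows "i + jump_coeff R i u \<le> j + jump_coeff R' j u"
  using assms by (auto simp: jump_coeff_def indicator_def)


section \<open>Atoms of a Poisson random measure on a strip\<close>

lemma time_slab_sets:
  assumes "0 \<le> r"
  shows "{r<..t} \<times> {0..L} \<in> sets (intensity L)" "{r<..<t} \<times> {0..L} \<in> sets (intensity L)"
proof -
  have *: "A \<times> {0..L} \<in> sets (intensity L)" if "A \<in> sets borel" "A \<subseteq> {0<..}" for A
    unfolding intensity_def using that
    by (intro pair_measureI) (auto simp: sets_restrict_space_iff)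
  show "{r<..t} \<times> {0..L} \<in> sets (intensity L)" "{r<..<t} \<times> {0..L} \<in> sets (intensity L)"
    using assms by (auto intro!: *)
qed

text \<open>The factor stays \<open>measure lborel {0..L}\<close> instead of \<open>L\<close>, so
  that the formula also covers negative \<open>L\<close>.\<close>

lemma emeasure_intensity_time_slab:
  assumes "0 \<le> r" "r \<le> t"
  shows "emeasure (intensity L) ({r<..t} \<times> {0..L}) =
    ennreal ((t - r) * measure lborel {0..L})"
proof -
  interpret S: sigma_finite_measure "restrict_space lborel {0..L}"
    by (rule sigma_finite_measure_restrict_space) (auto simp: lborel.sigma_finite_measure_axioms)
  have "emeasure (intensity L) ({r<..t} \<times> {0..L}) =
      emeasure (restrict_space lborel {0<..}) {r<..t} *
      emeasure (restrict_space lborel {0..L}) {0..L}"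
    unfolding intensity_def using assms
    by (intro S.emeasure_pair_measure_Times) (auto simp: sets_restrict_space_iff)
  also have "\<dots> = emeasure lborel {r<..t} * emeasure lborel {0..L}"
    using assms by (simp add: emeasure_restrict_space subset_eq)
  also have "\<dots> = ennreal ((t - r) * measure lborel {0..L})"
    using assms by (simp add: emeasure_eq_ennreal_measure ennreal_mult emeasure_lborel_Icc_eq)
  finally show ?thesis .
qed

text \<open>With mean m, a count of 0 or 1 has probability (1 + m) exp(-m) >= (1 + m)(1 - m) = 1 -
  m^2. The quadratic order lets a union bound over ever finer partitions tend to 0.\<close>

lemma prob_poisson_gt_one_le:
  assumes "prob_space M" "poisson_random_measure M \<mu> N" "A \<in> sets \<mu>" "emeasure \<mu> A < \<infinity>"
  shows "measure M {\<omega>\<in>space M. \<not> emeasure (N \<omega>) A \<le> 1} \<le> (measure \<mu> A)\<^sup>2"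
proof -
  interpret prob_space M by fact
  let ?m = "measure \<mu> A"
  let ?E = "\<lambda>k::nat. {\<omega>\<in>space M. emeasure (N \<omega>) A = of_nat k}"
  have [measurable]: "(\<lambda>\<omega>. emeasure (N \<omega>) A) \<in> borel_measurable M"
    using assms by (auto simp: poisson_random_measure_def)
  have P: "prob (?E k) = ?m ^ k / fact k * exp (- ?m)" for k
    using assms by (auto simp: poisson_random_measure_def)
  have "prob {\<omega>\<in>space M. \<not> emeasure (N \<omega>) A \<le> 1} \<le> prob (space M - (?E 0 \<union> ?E 1))"
    by (intro finite_measure_mono) auto
  also have "\<dots> = 1 - prob (?E 0 \<union> ?E 1)"
    by (intro prob_compl) auto
  also have "prob (?E 0 \<union> ?E 1) = prob (?E 0) + prob (?E 1)"
    by (intro finite_measure_Union) auto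
  also have "\<dots> = (1 + ?m) * exp (- ?m)"
    unfolding P by (simp add: algebra_simps)
  also have "1 - (1 + ?m) * exp (- ?m) \<le> 1 - (1 + ?m) * (1 - ?m)"
    using exp_ge_add_one_self[of "- ?m"] by (intro diff_mono mult_left_mono) auto
  finally show ?thesis
    by (simp add: algebra_simps power2_eq_square)
qed

text \<open>Cut (0, T] into T(n+1) cells of length 1/(n+1). The probability that some cell carries
  more than one atom is at most of order 1/n, so almost surely some n has no such cell, and the left
  end of the cell containing \<open>s\<close> serves as \<open>r\<close>. The bounded horizon keeps
  the number of cells finite.\<close>

lemma AE_atoms_separated_upto:
  fixes T :: nat
  assumes "prob_space M" "poisson_random_measure M (intensity L) N"
  shows "AE \<omega> in M. \<forall>s. 0 < s \<and> s \<le> real T \<longrightarrow>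
    (\<exists>r\<ge>0. r < s \<and> emeasure (N \<omega>) ({r<..s} \<times> {0..L}) \<le> 1)"
proof -
  interpret prob_space M by fact
  define l where "l = measure lborel {0..L}"
  define A where "A n k = {real k / real (Suc n)<..real (Suc k) / real (Suc n)} \<times> {0..L}" for n k
  define D where "D n k = {\<omega>\<in>space M. \<not> emeasure (N \<omega>) (A n k) \<le> 1}" for n k
  define B where "B n = (\<Union>k<T * Suc n. D n k)" for n
  have A_sets: "A n k \<in> sets (intensity L)" for n k
    unfolding A_def by (intro time_slab_sets) auto
  have A_emeasure: "emeasure (intensity L) (A n k) = ennreal (l / real (Suc n))" for n k
    unfolding A_def l_def by (subst emeasure_intensity_time_slab) (auto simp: field_simps)
  have l: "0 \<le> l" by (simp add: l_def)
  have [measurable]: "(\<lambda>\<omega>. emeasure (N \<omega>) (A n k)) \<in> borel_measurable M" for n k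
    using assms A_sets by (auto simp: poisson_random_measure_def)
  have D_sets [measurable]: "D n k \<in> sets M" for n k
    unfolding D_def by measurable
  have B_sets [measurable]: "B n \<in> sets M" for n
    unfolding B_def by measurable
  have D_prob: "prob (D n k) \<le> (l / real (Suc n))\<^sup>2" for n k
    using prob_poisson_gt_one_le[OF assms A_sets, of n k] l
    by (simp add: D_def A_emeasure measure_def)
  have B_prob: "prob (B n) \<le> real T * l\<^sup>2 / real (Suc n)" for n
  proof -
    have "prob (B n) \<le> (\<Sum>k<T * Suc n. prob (D n k))"
      unfolding B_def by (intro finite_measure_subadditive_finite) auto
    also have "\<dots> \<le> (\<Sum>k<T * Suc n. (l / real (Suc n))\<^sup>2)"
      by (intro sum_mono D_prob)
    also have "\<dots> = real T * real (Suc n) * (l / real (Suc n))\<^sup>2"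
      by (simp del: of_nat_Suc mult_Suc_right)
    also have "\<dots> = real T * l\<^sup>2 / real (Suc n)"
      by (simp add: power2_eq_square del: of_nat_Suc)
    finally show ?thesis .
  qed
  have "(\<lambda>n. real T * l\<^sup>2 / real (Suc n)) \<longlonglongrightarrow> 0"
    using tendsto_mult_right_zero[OF LIMSEQ_inverse_real_of_nat, of "real T * l\<^sup>2"]
    by (simp add: divide_inverse)
  \<comment> \<open>The intersection lies in every \<open>B n\<close>, so its probability is below
    every term of a null sequence; the \<open>B n\<close> need not be monotone.\<close>
  moreover have "prob (\<Inter>n. B n) \<le> real T * l\<^sup>2 / real (Suc n)" for n
    by (rule order_trans[OF finite_measure_mono B_prob]) auto
  ultimately have "prob (\<Inter>n. B n) \<le> 0"
    by (intro LIMSEQ_le_const) auto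
  then have "prob (\<Inter>n. B n) = 0"
    using measure_nonneg[of M "\<Inter>n. B n"] by linarith
  then have "(\<Inter>n. B n) \<in> null_sets M"
    by (auto simp: null_sets_def emeasure_eq_measure)
  then have "AE \<omega> in M. \<omega> \<notin> (\<Inter>n. B n)" by (rule AE_not_in)
  with AE_space show ?thesis
  proof eventually_elim
    case \<omega>: (elim \<omega>)
    from \<omega>(2) obtain n where n: "\<omega> \<notin> B n" by auto
    have "\<exists>r\<ge>0. r < s \<and> emeasure (N \<omega>) ({r<..s} \<times> {0..L}) \<le> 1"
      if s: "0 < s" "s \<le> real T" for s
    proof -
      \<comment> \<open>Cells are open on the left and closed on the right, hence the ceiling minus
        1: a grid point belongs to the cell that it closes. As \<open>s\<close> is positive,
        \<open>nat\<close> truncates nothing.\<close>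
      define k where "k = nat (\<lceil>s * real (Suc n)\<rceil> - 1)"
      have pos: "0 < s * real (Suc n)" using s by simp
      then have k: "real k = of_int \<lceil>s * real (Suc n)\<rceil> - 1"
        unfolding k_def by (simp add: of_nat_nat)
      have k1: "real k < s * real (Suc n)" "s * real (Suc n) \<le> real k + 1"
        unfolding k by linarith+
      have "s * real (Suc n) \<le> real (T * Suc n)"
        using mult_right_mono[OF s(2), of "real (Suc n)"] by (simp add: algebra_simps)
      with k1 have "k < T * Suc n" by linarith
      with n \<omega>(1) have "emeasure (N \<omega>) (A n k) \<le> 1"
        by (auto simp: B_def D_def)
      moreover have "emeasure (N \<omega>) ({real k / real (Suc n)<..s} \<times> {0..L}) \<le>
          emeasure (N \<omega>) (A n k)"
      proof (rule emeasure_mono)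
        show "{real k / real (Suc n)<..s} \<times> {0..L} \<subseteq> A n k"
        proof -
          have "s \<le> real (Suc k) / real (Suc n)"
            using k1(2) by (simp add: pos_le_divide_eq)
          then show ?thesis unfolding A_def by auto
        qed
        show "A n k \<in> sets (N \<omega>)"
          using assms(2) \<omega>(1) A_sets by (auto simp: poisson_random_measure_def)
      qed
      ultimately show ?thesis
        using k1 by (intro exI[of _ "real k / real (Suc n)"]) (auto simp: field_simps)
    qed
    then show ?case by blast
  qed
qed

lemma AE_atoms_separated:
  assumes "prob_space M" "poisson_random_measure M (intensity L) N"
  shows "AE \<omega> in M. \<forall>s>0. \<exists>r\<ge>0. r < s \<and> emeasure (N \<omega>) ({r<..s} \<times> {0..L}) \<le> 1"
proof -
  have "AE \<omega> in M. \<forall>T::nat. \<forall>s. 0 < s \<and> s \<le> real T \<longrightarrow>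
      (\<exists>r\<ge>0. r < s \<and> emeasure (N \<omega>) ({r<..s} \<times> {0..L}) \<le> 1)"
    unfolding AE_all_countable using AE_atoms_separated_upto[OF assms] by blast
  then show ?thesis
    by (rule AE_mp) (auto intro!: AE_I2, metis real_arch_simple)
qed

text \<open>Atoms do not accumulate at \<open>s\<close> from the left: open slabs shrinking to the
  empty set inside a slab of finite mass have mass tending to 0, and a mass that is an integer below
  1 vanishes.\<close>

lemma time_slab_null_left:
  fixes n :: "(real \<times> real) measure"
  assumes sets_n: "sets n = sets (intensity L)"
    and int_valued: "\<And>A. A \<in> sets n \<Longrightarrow> emeasure n A = \<infinity> \<or> (\<exists>k::nat. emeasure n A = of_nat k)"
    and r: "0 \<le> r" "r < s" "emeasure n ({r<..s} \<times> {0..L}) < \<infinity>"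
  obtains r' where "r \<le> r'" "r' < s" "emeasure n ({r'<..<s} \<times> {0..L}) = 0"
proof -
  \<comment> \<open>The sequence starts at \<open>c 0 = r\<close>, so all slabs lie in the one of
    finite mass, and increases to \<open>s\<close> without reaching it.\<close>
  define c where "c k = s - (s - r) / real (Suc k)" for k
  have c: "r \<le> c k" "c k < s" for k
  proof -
    have "(s - r) / real (Suc k) \<le> (s - r) / 1"
      using r by (intro divide_left_mono) auto
    then show "r \<le> c k" by (simp add: c_def)
    show "c k < s" using r by (simp add: c_def)
  qed
  have c_lim: "c \<longlonglongrightarrow> s"
    unfolding c_def
    using tendsto_diff[OF tendsto_const[of s]
        tendsto_mult_right_zero[OF LIMSEQ_inverse_real_of_nat, of "s - r"]]
    by (simp add: divide_inverse)
  have c_mono: "c j \<le> c k" if "j \<le> k" for j k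
    using r that unfolding c_def by (intro diff_left_mono divide_left_mono) auto
  let ?A = "\<lambda>k. {c k<..<s} \<times> {0..L}"
  have A_sets: "?A k \<in> sets n" for k
    unfolding sets_n using c[of k] r by (intro time_slab_sets) auto
  have fin: "emeasure n (?A k) < \<infinity>" for k
  proof -
    have "emeasure n (?A k) \<le> emeasure n ({r<..s} \<times> {0..L})"
      using c[of k] r by (intro emeasure_mono) (auto simp: sets_n intro!: time_slab_sets)
    also note r(3)
    finally show ?thesis .
  qed
  have "(\<Inter>k. ?A k) = {}"
  proof -
    have "\<exists>k. x \<le> c k" if "x < s" for x
      using that LIMSEQ_le_const2[OF c_lim, of x] by (meson less_imp_le not_le)
    then show ?thesis by (fastforce simp flip: not_less)
  qed
  moreover have "(\<lambda>k. emeasure n (?A k)) \<longlonglongrightarrow> emeasure n (\<Inter>k. ?A k)"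
    using A_sets fin c_mono
    by (intro Lim_emeasure_decseq)
      (auto simp: decseq_def simp flip: less_top intro: order_le_less_trans[OF c_mono])
  ultimately have "(\<lambda>k. emeasure n (?A k)) \<longlonglongrightarrow> 0" by simp
  then have "eventually (\<lambda>k. emeasure n (?A k) < 1) sequentially"
    by (rule order_tendstoD) simp
  then obtain k where k: "emeasure n (?A k) < 1"
    by (auto simp: eventually_sequentially)
  with int_valued[OF A_sets[of k]] fin[of k] have "emeasure n (?A k) = 0"
    by auto
  with c[of k] that show ?thesis by blast
qed


section \<open>Pathwise comparison\<close>

text \<open>Turns the integral equation started at time 0 into one for the increment of a path
  between \<open>r\<close> and \<open>t\<close>.\<close>

lemma set_integrable_time_increment:
  fixes f :: "real \<times> real \<Rightarrow> real"
  assumes sets_n: "sets n = sets (intensity L)" and "0 \<le> r" "r \<le> t"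
    and f: "set_integrable n ({0<..t} \<times> {0..L}) f"
  shows "set_integrable n ({r<..t} \<times> {0..L}) f"
    and "(LINT p:{0<..t} \<times> {0..L}|n. f p) - (LINT p:{0<..r} \<times> {0..L}|n. f p) =
      (LINT p:{r<..t} \<times> {0..L}|n. f p)"
proof -
  have i: "set_integrable n ({0<..r} \<times> {0..L}) f" "set_integrable n ({r<..t} \<times> {0..L}) f"
    using assms by (auto intro!: set_integrable_subset[OF f] time_slab_sets)
  show "set_integrable n ({r<..t} \<times> {0..L}) f" by (rule i)
  have U: "{0<..t} \<times> {0..L} = ({0<..r} \<times> {0..L}) \<union> ({r<..t} \<times> {0..L})"
    using assms by auto
  show "(LINT p:{0<..t} \<times> {0..L}|n. f p) - (LINT p:{0<..r} \<times> {0..L}|n. f p) =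
      (LINT p:{r<..t} \<times> {0..L}|n. f p)"
    unfolding U by (subst set_integral_Un[OF _ i]) auto
qed

lemma cadlag_discrete_right:
  fixes f :: "real \<Rightarrow> 'b::discrete_topology"
  assumes "cadlag f" "0 \<le> t"
  shows "eventually (\<lambda>r. f r = f t) (at_right t)"
  using assms by (auto simp: cadlag_def tendsto_discrete)

text \<open>In a discrete space convergence is eventual equality, so the path is constant just
  before \<open>t\<close>; uniqueness of limits identifies the constant with
  \<open>left_limit\<close>.\<close>

lemma cadlag_discrete_left:
  fixes f :: "real \<Rightarrow> 'b::{discrete_topology, t2_space}"
  assumes "cadlag f" "0 < t"
  shows "eventually (\<lambda>r. f r = left_limit f t) (at_left t)"
proof -
  from assms obtain l where l: "(f \<longlongrightarrow> l) (at_left t)" by (auto simp: cadlag_def)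
  then have "left_limit f t = l"
    unfolding left_limit_def by (intro tendsto_Lim) auto
  with l show ?thesis by (simp add: tendsto_discrete)
qed

text \<open>A deterministic statement about one path. At the first bad time \<open>s\<close>, both
  increments are integrals over a slab of mass at most 1 concentrated on time \<open>s\<close>.
  Integrating the bound given by \<open>mono\<close> over this slab restores the order; no atom has
  to be picked, so \<open>n\<close> need not be written as a sum of point masses.\<close>

lemma jump_path_le:
  fixes n :: "(real \<times> real) measure" and \<kappa>1 \<kappa>2 :: "real \<Rightarrow> int \<Rightarrow> real \<Rightarrow> int"
    and Y1 Y2 :: "real \<Rightarrow> int"
  defines "f1 \<equiv> \<lambda>(s, u). real_of_int (\<kappa>1 s (left_limit Y1 s) u)"
    and "f2 \<equiv> \<lambda>(s, u). real_of_int (\<kappa>2 s (left_limit Y2 s) u)"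
  assumes sets_n: "sets n = sets (intensity L)"
    and int_valued: "\<And>A. A \<in> sets n \<Longrightarrow> emeasure n A = \<infinity> \<or> (\<exists>k::nat. emeasure n A = of_nat k)"
    and separated: "\<And>s. 0 < s \<Longrightarrow> \<exists>r\<ge>0. r < s \<and> emeasure n ({r<..s} \<times> {0..L}) \<le> 1"
    and mono: "\<And>s i j u. i \<in> states \<Longrightarrow> j \<in> states \<Longrightarrow> i \<le> j \<Longrightarrow>
      i + \<kappa>1 s i u \<le> j + \<kappa>2 s j u"
    and cadlag: "cadlag Y1" "cadlag Y2"
    and states: "\<And>t. 0 \<le> t \<Longrightarrow> Y1 t \<in> states" "\<And>t. 0 \<le> t \<Longrightarrow> Y2 t \<in> states"
    and int1: "\<And>t. 0 \<le> t \<Longrightarrow> set_integrable n ({0<..t} \<times> {0..L}) f1"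
    and int2: "\<And>t. 0 \<le> t \<Longrightarrow> set_integrable n ({0<..t} \<times> {0..L}) f2"
    and eq1: "\<And>t. 0 \<le> t \<Longrightarrow> real_of_int (Y1 t) = y + (LINT p:{0<..t} \<times> {0..L}|n. f1 p)"
    and eq2: "\<And>t. 0 \<le> t \<Longrightarrow> real_of_int (Y2 t) = y + (LINT p:{0<..t} \<times> {0..L}|n. f2 p)"
    and t: "0 \<le> t"
  shows "Y1 t \<le> Y2 t"
proof (rule ccontr)
  assume "\<not> Y1 t \<le> Y2 t"
  define B where "B = {t. 0 \<le> t \<and> \<not> Y1 t \<le> Y2 t}"
  have "t \<in> B" using t \<open>\<not> Y1 t \<le> Y2 t\<close> by (simp add: B_def)
  have B_bdd: "bdd_below B" by (auto simp: B_def)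
  define s where "s = Inf B"
  have s_le: "s \<le> r" if "r \<in> B" for r
    unfolding s_def using that B_bdd by (rule cInf_lower)
  have "0 \<le> s" unfolding s_def using \<open>t \<in> B\<close> by (intro cInf_greatest) (auto simp: B_def)
  \<comment> \<open>The infimum is attained: were the order intact at \<open>s\<close>,
    right-constancy would keep it on some [s, d), and every bad time would be at least
    \<open>d\<close>.\<close>
  have "s \<in> B"
  proof (rule ccontr)
    assume "s \<notin> B"
    then have "Y1 s \<le> Y2 s" using \<open>0 \<le> s\<close> by (simp add: B_def)
    have "eventually (\<lambda>r. Y1 r \<le> Y2 r) (at_right s)"
      using cadlag_discrete_right[OF cadlag(1) \<open>0 \<le> s\<close>] cadlag_discrete_right[OF cadlag(2) \<open>0 \<le> s\<close>]
      by eventually_elim (use \<open>Y1 s \<le> Y2 s\<close> in simp)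
    then obtain d where d: "s < d" "\<And>r. s < r \<Longrightarrow> r < d \<Longrightarrow> Y1 r \<le> Y2 r"
      by (auto simp: eventually_at_right_field)
    have "d \<le> r" if "r \<in> B" for r
    proof -
      from that \<open>s \<notin> B\<close> s_le have "s < r" by (metis order_le_less)
      with d(2)[of r] that show ?thesis by (force simp: B_def)
    qed
    then have "d \<le> s" unfolding s_def using \<open>t \<in> B\<close> by (intro cInf_greatest) auto
    with \<open>s < d\<close> show False by simp
  qed
  then have bad: "Y2 s < Y1 s" by (simp add: B_def)
  \<comment> \<open>At time 0 the slab is empty, so both paths start at \<open>y\<close>.\<close>
  have "real_of_int (Y1 0) = real_of_int (Y2 0)" using eq1[of 0] eq2[of 0]
    by (simp add: set_lebesgue_integral_def)
  with bad \<open>0 \<le> s\<close> have "0 < s" by (cases "s = 0") auto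
  obtain r0 where r0: "0 \<le> r0" "r0 < s" "emeasure n ({r0<..s} \<times> {0..L}) \<le> 1"
    using separated[OF \<open>0 < s\<close>] by auto
  then have r0_fin: "emeasure n ({r0<..s} \<times> {0..L}) < \<infinity>"
    by (auto intro: order_le_less_trans)
  obtain r1 where r1: "r0 \<le> r1" "r1 < s" "emeasure n ({r1<..<s} \<times> {0..L}) = 0"
    using time_slab_null_left[OF sets_n int_valued r0(1,2) r0_fin] by blast
  define l1 where "l1 = left_limit Y1 s"
  define l2 where "l2 = left_limit Y2 s"
  \<comment> \<open>Three demands on \<open>r\<close>: past \<open>r0\<close> the slab up to
    \<open>s\<close> has mass at most 1, past \<open>r1\<close> none of it lies strictly before
    \<open>s\<close>, and close to \<open>s\<close> both paths sit at their left limits.\<close>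
  have "eventually (\<lambda>r. Y1 r = l1 \<and> Y2 r = l2 \<and> r \<in> {r1<..<s}) (at_left s)"
    unfolding l1_def l2_def
    using cadlag_discrete_left[OF cadlag(1) \<open>0 < s\<close>] cadlag_discrete_left[OF cadlag(2) \<open>0 < s\<close>]
      eventually_at_left_real[OF r1(2)]
    by eventually_elim auto
  then obtain r where r: "Y1 r = l1" "Y2 r = l2" "r1 < r" "r < s"
    by (metis (mono_tags, lifting) eventually_happens greaterThanLessThan_iff trivial_limit_at_left_real)
  have "0 \<le> r" using r r1 r0 by simp
  \<comment> \<open>Since \<open>r\<close> lies before the infimum \<open>s\<close> of the bad
    times, the order still holds at \<open>r\<close>, hence for the left limits.\<close>
  have l: "l1 \<in> states" "l2 \<in> states" "l1 \<le> l2"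
    using states[of r] r \<open>0 \<le> r\<close> s_le[of r] by (auto simp: B_def)
  let ?A = "{r<..s} \<times> {0..L}"
  have A_sets: "?A \<in> sets n"
    unfolding sets_n by (intro time_slab_sets \<open>0 \<le> r\<close>)
  have A_le: "emeasure n ?A \<le> 1"
    by (rule order_trans[OF emeasure_mono r0(3)])
      (use r r1 r0 in \<open>auto simp: sets_n intro!: time_slab_sets\<close>)
  then have A_fin: "emeasure n ?A < \<infinity>" by (auto intro: order_le_less_trans)
  have A_measure: "measure n ?A \<le> 1"
    using A_le by (simp add: measure_def enn2real_leI)
  have null: "{r<..<s} \<times> {0..L} \<in> null_sets n"
    by (rule null_sets_subset[of "{r1<..<s} \<times> {0..L}"])
      (use r r1 r0 \<open>0 \<le> r\<close> in \<open>auto simp: sets_n null_sets_def intro!: time_slab_sets\<close>)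
  note inc1 = set_integrable_time_increment[OF sets_n \<open>0 \<le> r\<close> less_imp_le[OF r(4)] int1[OF \<open>0 \<le> s\<close>]]
  note inc2 = set_integrable_time_increment[OF sets_n \<open>0 \<le> r\<close> less_imp_le[OF r(4)] int2[OF \<open>0 \<le> s\<close>]]
  have "real_of_int (Y1 s) - real_of_int (Y2 s) =
      real_of_int l1 - real_of_int l2 + ((LINT p:?A|n. f1 p) - (LINT p:?A|n. f2 p))"
    using eq1[OF \<open>0 \<le> s\<close>] eq2[OF \<open>0 \<le> s\<close>] eq1[OF \<open>0 \<le> r\<close>] eq2[OF \<open>0 \<le> r\<close>] r inc1(2) inc2(2)
    by linarith
  also have "(LINT p:?A|n. f1 p) - (LINT p:?A|n. f2 p) = (LINT p:?A|n. f1 p - f2 p)"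
    by (rule set_integral_diff(2)[OF inc1(1) inc2(1), symmetric])
  also have "\<dots> \<le> (LINT p:?A|n. real_of_int l2 - real_of_int l1)"
  proof (rule set_integral_mono_AE)
    show "set_integrable n ?A (\<lambda>p. f1 p - f2 p)"
      by (rule set_integral_diff(1)[OF inc1(1) inc2(1)])
    show "set_integrable n ?A (\<lambda>p. real_of_int l2 - real_of_int l1)"
      using A_sets A_fin unfolding set_integrable_def by (intro integrable_scaleR_left) auto
    \<comment> \<open>Outside the null slab every point has time exactly \<open>s\<close>, so both
      integrands are evaluated at the left limits \<open>l1\<close> and \<open>l2\<close>, where
      \<open>mono\<close> applies to the common mark.\<close>
    show "AE p\<in>?A in n. f1 p - f2 p \<le> real_of_int l2 - real_of_int l1"
      using AE_not_in[OF null]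
    proof eventually_elim
      case (elim p)
      show ?case
      proof
        assume "p \<in> ?A"
        with elim obtain u where p: "p = (s, u)" by (cases p) force
        have "l1 + \<kappa>1 s l1 u \<le> l2 + \<kappa>2 s l2 u" by (rule mono[OF l])
        then show "f1 p - f2 p \<le> real_of_int l2 - real_of_int l1"
          by (simp add: p f1_def f2_def flip: l1_def l2_def)
      qed
    qed
  qed
  also have "\<dots> = measure n ?A * (real_of_int l2 - real_of_int l1)"
    using A_sets A_fin by (subst set_integral_const) auto
  \<comment> \<open>Here mass at most 1 is essential: the slack \<open>l2 - l1\<close> can be spent
    only once.\<close>
  also have "\<dots> \<le> 1 * (real_of_int l2 - real_of_int l1)"
    using A_measure l by (intro mult_right_mono) auto
  finally show False using bad by simp
qed

text \<open>The coefficients may depend on time and \<omega>, so either of them can carry the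
  diffusion \<open>X\<close>; exchanging the roles yields both halves of the theorem.\<close>

lemma AE_jump_solution_le:
  assumes "prob_space M" "poisson_random_measure M (intensity L) N"
    and sol1: "jump_solution M F L N \<kappa>1 i\<^sub>0 Y1" and sol2: "jump_solution M F L N \<kappa>2 i\<^sub>0 Y2"
    and mono: "\<And>s \<omega> i j u. i \<in> states \<Longrightarrow> j \<in> states \<Longrightarrow> i \<le> j \<Longrightarrow>
      i + \<kappa>1 s \<omega> i u \<le> j + \<kappa>2 s \<omega> j u"
  shows "AE \<omega> in M. \<forall>t\<ge>0. Y1 t \<omega> \<le> Y2 t \<omega>"
  using AE_space AE_atoms_separated[OF assms(1,2)]
    conjunct2[OF sol1[unfolded jump_solution_def]] conjunct2[OF sol2[unfolded jump_solution_def]]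
proof eventually_elim
  case (elim \<omega>)
  have N: "sets (N \<omega>) = sets (intensity L)"
    "\<And>A. A \<in> sets (N \<omega>) \<Longrightarrow> emeasure (N \<omega>) A = \<infinity> \<or> (\<exists>k::nat. emeasure (N \<omega>) A = of_nat k)"
    using assms(2) elim(1) by (auto simp: poisson_random_measure_def)
  show ?case
  proof (intro allI impI)
    fix t :: real assume "0 \<le> t"
    show "Y1 t \<omega> \<le> Y2 t \<omega>"
      by (rule jump_path_le[of "N \<omega>" L "\<lambda>s. \<kappa>1 s \<omega>" "\<lambda>s. \<kappa>2 s \<omega>" "\<lambda>r. Y1 r \<omega>" "\<lambda>r. Y2 r \<omega>"
            "real_of_int i\<^sub>0"])
        (use N elim mono \<open>0 \<le> t\<close> in auto)
  qed
qed


section \<open>Comparison of the rates\<close>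

text \<open>With two states, zero row sums make the off-diagonal rate equal to
  \<open>- q x i i\<close>, which \<open>max_rate\<close> dominates. Boundedness is what makes the
  SUP and INF in \<open>Q_bar\<close> and \<open>Q_star\<close> genuine bounds, as on the reals they
  are arbitrary otherwise.\<close>

lemma standing_assumptions_rates:
  fixes q :: "real^'d \<Rightarrow> int \<Rightarrow> int \<Rightarrow> real"
  assumes "standing_assumptions a \<sigma> q" and ij: "i \<in> states" "j \<in> states" "i \<noteq> j"
  shows "bdd_above (range (\<lambda>x. q x i j))" "bdd_below (range (\<lambda>x. q x i j))"
proof -
  have Q: "conservative_Q_matrix (q x)" for x
    using assms by (simp add: standing_assumptions_def)
  have "0 \<le> q x i j" for x
    using Q[of x] ij by (auto simp: conservative_Q_matrix_def)
  then show "bdd_below (range (\<lambda>x. q x i j))" by (intro bdd_belowI[of _ 0]) auto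
  have "q x i j \<le> max_rate q x" for x
  proof -
    have "q x i j = - q x i i"
      using Q[of x] ij by (auto simp: conservative_Q_matrix_def)
    also have "\<dots> \<le> max_rate q x"
      unfolding max_rate_def using ij by (intro Max_ge) auto
    finally show ?thesis .
  qed
  moreover have "bdd_above (range (max_rate q))"
    using assms by (simp add: standing_assumptions_def)
  ultimately show "bdd_above (range (\<lambda>x. q x i j))"
    by (auto simp: bdd_above_def intro: order_trans)
qed

text \<open>Supplies the inequality between up-rates in \<open>jump_coeff_mono\<close>; the one
  between the sums is a hypothesis of the theorem.\<close>

lemma Q_star_le_rate_le_Q_bar:
  fixes q :: "real^'d \<Rightarrow> int \<Rightarrow> int \<Rightarrow> real"
  assumes "standing_assumptions a \<sigma> q"
  shows "q x 1 2 \<le> Q_bar q 1 2" "Q_star q 1 2 \<le> q x 1 2"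
  using standing_assumptions_rates[OF assms, of 1 2]
  by (auto simp: Q_bar_def Q_star_def Q_of_rates_def intro!: cSUP_upper cINF_lower)

theorem lemma2p4:
  fixes M :: "'w measure" and F :: "real \<Rightarrow> 'w measure"
    and \<tau> :: real and i\<^sub>0 :: int
    and a :: "real^'d \<Rightarrow> int \<Rightarrow> real^'d" and \<sigma> :: "real^'d \<Rightarrow> int \<Rightarrow> real^'d^'d" and b :: "int \<Rightarrow> real"
    and q :: "real^'d \<Rightarrow> int \<Rightarrow> int \<Rightarrow> real"
    and W :: "real \<Rightarrow> 'w \<Rightarrow> real^'d" and N :: "'w \<Rightarrow> (real \<times> real) measure"
    and X :: "real \<Rightarrow> 'w \<Rightarrow> real^'d" and \<Lambda> \<Lambda>_bar \<Lambda>_star :: "real \<Rightarrow> 'w \<Rightarrow> int"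
  assumes "0 < \<tau>"
    and "standing_assumptions a \<sigma> q"
    and "filtered_prob_space M F"
    and "wiener_process M F W"
    and "poisson_noise M F (2 * rate_bound q) N"
    and "independent_noises M (2 * rate_bound q) W N"
    and "i\<^sub>0 \<in> states"
    and "switching_diffusion_solution M F \<tau> a \<sigma> b q (2 * rate_bound q) W N i\<^sub>0 X \<Lambda>"
    and "jump_solution M F (2 * rate_bound q) N (\<lambda>s \<omega>. jump_coeff (Q_bar q)) i\<^sub>0 \<Lambda>_bar"
    and "jump_solution M F (2 * rate_bound q) N (\<lambda>s \<omega>. jump_coeff (Q_star q)) i\<^sub>0 \<Lambda>_star"
  shows "(0 < Q_bar q 2 1 \<and> (\<forall>x. Q_bar q 1 2 + Q_bar q 2 1 \<le> q x 1 2 + q x 2 1) \<longrightarrow>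
            (AE \<omega> in M. \<forall>t\<ge>0. \<Lambda> t \<omega> \<le> \<Lambda>_bar t \<omega>)) \<and>
         (0 < Q_star q 1 2 \<and> (\<forall>x. q x 1 2 + q x 2 1 \<le> Q_star q 1 2 + Q_star q 2 1) \<longrightarrow>
            (AE \<omega> in M. \<forall>t\<ge>0. \<Lambda>_star t \<omega> \<le> \<Lambda> t \<omega>))"
proof -
  have P: "prob_space M" using assms(3) by (simp add: filtered_prob_space_def)
  have N: "poisson_random_measure M (intensity (2 * rate_bound q)) N"
    using assms(5) by (simp add: poisson_noise_def)
  have sol: "jump_solution M F (2 * rate_bound q) N (\<lambda>s \<omega>. jump_coeff (q (X s \<omega>))) i\<^sub>0 \<Lambda>"
    using assms(8) by (simp add: switching_diffusion_solution_def)
  note rates = Q_star_le_rate_le_Q_bar[OF assms(2)]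
  \<comment> \<open>In the first half \<open>q (X s \<omega>)\<close> drives the smaller chain and
    \<open>Q_bar q\<close> the larger one; in the second, \<open>Q_star q\<close> drives the smaller
    and \<open>q (X s \<omega>)\<close> the larger.\<close>
  show ?thesis
  proof (intro conjI impI; elim conjE)
    assume "\<forall>x. Q_bar q 1 2 + Q_bar q 2 1 \<le> q x 1 2 + q x 2 1"
    then show "AE \<omega> in M. \<forall>t\<ge>0. \<Lambda> t \<omega> \<le> \<Lambda>_bar t \<omega>"
      using rates by (intro AE_jump_solution_le[OF P N sol assms(9)] jump_coeff_mono) auto
  next
    assume "\<forall>x. q x 1 2 + q x 2 1 \<le> Q_star q 1 2 + Q_star q 2 1"
    then show "AE \<omega> in M. \<forall>t\<ge>0. \<Lambda>_star t \<omega> \<le> \<Lambda> t \<omega>"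
      using rates by (intro AE_jump_solution_le[OF P N assms(10) sol] jump_coeff_mono) auto
  qed
qed

end
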